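(* Let $A\in\mathbb{C}^{N\times N}$, $\mathbf b,\mathbf x_0\in\mathbb{C}^N$, $\mathbf r_0=\mathbf b-A\mathbf x_0\neq\mathbf 0$, $m\ge1$, and let $V_{m+1}\in\mathbb{C}^{N\times(m+1)}$ have linearly independent columns with first column $\mathbf r_0/\|\mathbf r_0\|$, such that for each $j\le m+1$ the first $j$ columns $V_j$ form a basis of $\mathcal K_j(A,\mathbf r_0)$ and $AV_m=V_{m+1}\underline{H_m}$ with $\underline{H_m}\in\mathbb{C}^{(m+1)\times m}$ upper Hessenberg. Let $S\in\mathbb{C}^{s\times N}$ be such that $SV_{m+1}$ has full column rank, with economy QR decomposition $SV_{m+1}=\widehat W_{m+1}R_{m+1}$ ($R_{m+1}$ upper triangular with positive diagonal), and set $\underline{\widehat H_m}=R_{m+1}\underline{H_m}$, so that $SAV_m=\widehat W_{m+1}\underline{\widehat H_m}$. Let $\widehat H_m$ be the square matrix formed by the first $m$ rows of $\underline{\widehat H_m}$ and assume $\widehat H_m$ is nonsingular. Let $c_m,s_m$ be the cosine and sine of the $m$-th Givens rotation in the progressive Givens QR factorization of $\underline{\widehat H_m}$. Then the sketched GMRES iterates $\widetilde{\mathbf x}^{(G)}_{m-1},\widetilde{\mathbf x}^{(G)}_m$ and the sketched FOM iterate $\widetilde{\mathbf x}_m^{(F)}$ satisfy $$\widetilde{\mathbf x}_m^{(G)}=c_m^2\,\widetilde{\mathbf x}_m^{(F)}+s_m^2\,\widetilde{\mathbf x}_{m-1}^{(G)} .$$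
   Context: $\mathcal{K}_j(A,\mathbf r_0)=\mathrm{span}\{\mathbf r_0,\ldots,A^{j-1}\mathbf r_0\}$. Sketched GMRES: $\widetilde{\mathbf x}^{(G)}_j=\mathbf x_0+V_j\mathbf y$ with $\mathbf y$ minimizing $\|S(\mathbf r_0-AV_j\mathbf y)\|$ over $\mathbf y\in\mathbb{C}^j$ (Euclidean norm), and $\widetilde{\mathbf x}_0^{(G)}=\mathbf x_0$. Sketched FOM: $\widetilde{\mathbf x}_m^{(F)}=\mathbf x_0+\widetilde{\mathbf t}$ with $\widetilde{\mathbf t}\in\mathcal K_m(A,\mathbf r_0)$ such that $S(\mathbf b-A(\mathbf x_0+\widetilde{\mathbf t}))\perp S\mathcal K_m(A,\mathbf r_0)$; equivalently $\widetilde{\mathbf t}=V_m\widetilde{\mathbf y}_m^{(F)}$ with $\widehat H_m\widetilde{\mathbf y}_m^{(F)}=\|S\mathbf r_0\|\mathbf e_1$ when $V_m$ is replaced by the correspondingly sketch-orthonormalized basis $V_mR_m^{-1}$ and $\widehat H_m$ by $\widehat H_mR_m^{-1}$, or, in the given basis, $\widehat H_m\widetilde{\mathbf y}_m^{(F)}=\|S\mathbf r_0\|\mathbf e_1$ directly (here $R_m$ is the leading $m\times m$ block of $R_{m+1}$). Givens rotations: for $j=1,\dots,m$, $G_j$ is the $(m+1)\times(m+1)$ identity except for the $2\times2$ block in rows and columns $j,j+1$, which equals $\begin{bmatrix}c_j&s_je^{\mathrm i\varphi_j}\\-s_je^{-\mathrm i\varphi_j}&c_j\end{bmatrix}$ with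 $c_j,s_j\ge0$, $c_j^2+s_j^2=1$, $\varphi_j\in\mathbb{R}$, chosen so that the $(j+1,j)$ entry of $G_j\cdots G_1\underline{\widehat H_m}$ is zero; $G_m\cdots G_1\underline{\widehat H_m}$ is upper triangular. *)

theory Defs
  imports
    "HOL-Analysis.L2_Norm"
    "Jordan_Normal_Form.Schur_Decomposition"
    "Jordan_Normal_Form.DL_Rank"
begin

text \<open>Vectors and matrices are those of \<open>Jordan_Normal_Form\<close>, with entries indexed from 0.\<close>

definition cvec_norm :: "complex vec \<Rightarrow> real" where
  "cvec_norm v = L2_set (\<lambda>i. cmod (v $ i)) {..<dim_vec v}"

definition leading_block :: "nat \<Rightarrow> nat \<Rightarrow> complex mat \<Rightarrow> complex mat" where
  "leading_block nr nc M = mat nr nc (\<lambda>(i, k). M $$ (i, k))"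

abbreviation first_cols :: "nat \<Rightarrow> complex mat \<Rightarrow> complex mat" where
  "first_cols j V \<equiv> leading_block (dim_row V) j V"

text \<open>Linear dependence of a set does not see repeated columns, hence \<^const>\<open>distinct\<close>.\<close>

definition lin_indpt_cols :: "complex mat \<Rightarrow> bool" where
  "lin_indpt_cols M \<longleftrightarrow> distinct (cols M) \<and>
     \<not> module.lin_dep class_ring (module_vec TYPE(complex) (dim_row M)) (set (cols M))"

definition cols_basis_of :: "complex mat \<Rightarrow> complex vec set \<Rightarrow> bool" where
  "cols_basis_of M U \<longleftrightarrow> lin_indpt_cols M \<and>
     module.span class_ring (module_vec TYPE(complex) (dim_row M)) (set (cols M)) = U"

definition krylov :: "complex mat \<Rightarrow> complex vec \<Rightarrow> nat \<Rightarrow> complex vec set" where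
  "krylov A r j = module.span class_ring (module_vec TYPE(complex) (dim_vec r))
     ((\<lambda>i. (A ^\<^sub>m i) *\<^sub>v r) ` {..<j})"

definition upper_hessenberg :: "complex mat \<Rightarrow> bool" where
  "upper_hessenberg H \<longleftrightarrow>
     (\<forall>i < dim_row H. \<forall>k < dim_col H. k + 1 < i \<longrightarrow> H $$ (i, k) = 0)"

definition economy_qr :: "complex mat \<Rightarrow> complex mat \<Rightarrow> complex mat \<Rightarrow> bool" where
  "economy_qr M W R \<longleftrightarrow>
     W \<in> carrier_mat (dim_row M) (dim_col M) \<and>
     R \<in> carrier_mat (dim_col M) (dim_col M) \<and>
     M = W * R \<and>
     mat_adjoint W * W = 1\<^sub>m (dim_col M) \<and>
     upper_triangular R \<and>
     (\<forall>i < dim_col M. Im (R $$ (i, i)) = 0 \<and> Re (R $$ (i, i)) > 0)"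

text \<open>
  The rotation number \<open>j \<ge> 1\<close> acts on the rows \<open>j\<close> and \<open>j + 1\<close> when rows are counted from 1,
  that is, on the rows with index \<open>j - 1\<close> and \<open>j\<close>.
\<close>

definition givens_rotation :: "nat \<Rightarrow> nat \<Rightarrow> real \<Rightarrow> real \<Rightarrow> real \<Rightarrow> complex mat" where
  "givens_rotation n j c s \<phi> = mat n n (\<lambda>(i, k).
     if i = j - 1 \<and> k = j - 1 then complex_of_real c
     else if i = j - 1 \<and> k = j then complex_of_real s * cis \<phi>
     else if i = j \<and> k = j - 1 then - (complex_of_real s * cis (- \<phi>))
     else if i = j \<and> k = j then complex_of_real c
     else if i = k then 1 else 0)"

primrec givens_reduce ::
  "complex mat \<Rightarrow> (nat \<Rightarrow> real) \<Rightarrow> (nat \<Rightarrow> real) \<Rightarrow> (nat \<Rightarrow> real) \<Rightarrow> nat \<Rightarrow> complex mat" where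
  "givens_reduce H c s \<phi> 0 = H"
| "givens_reduce H c s \<phi> (Suc j) =
     givens_rotation (dim_row H) (Suc j) (c (Suc j)) (s (Suc j)) (\<phi> (Suc j)) *
     givens_reduce H c s \<phi> j"

text \<open>
  For an \<open>(m + 1) \<times> m\<close> upper Hessenberg matrix, upper triangularity of the final matrix
  follows from the conditions below and is not required separately.  The entry in row
  \<open>j + 1\<close> and column \<open>j\<close>, counted from 1, has index \<open>(j, j - 1)\<close>.
\<close>

definition progressive_givens ::
  "complex mat \<Rightarrow> (nat \<Rightarrow> real) \<Rightarrow> (nat \<Rightarrow> real) \<Rightarrow> (nat \<Rightarrow> real) \<Rightarrow> bool" where
  "progressive_givens H c s \<phi> \<longleftrightarrow> (\<forall>j \<in> {1..dim_col H}.
     c j \<ge> 0 \<and> s j \<ge> 0 \<and> (c j)\<^sup>2 + (s j)\<^sup>2 = 1 \<and>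
     givens_reduce H c s \<phi> j $$ (j, j - 1) = 0)"

text \<open>
  The iterates are given as relations: \<open>x\<close> is \<^emph>\<open>an\<close> iterate; neither existence nor uniqueness
  is built in.
\<close>

definition sketched_gmres_iterate ::
  "complex mat \<Rightarrow> complex mat \<Rightarrow> complex vec \<Rightarrow> complex vec \<Rightarrow> complex mat \<Rightarrow> nat \<Rightarrow> complex vec \<Rightarrow> bool"
  where
  "sketched_gmres_iterate S A b x0 V j x \<longleftrightarrow>
     (if j = 0 then x = x0
      else \<exists>y \<in> carrier_vec j.
        x = x0 + first_cols j V *\<^sub>v y \<and>
        (\<forall>z \<in> carrier_vec j.
           cvec_norm (S *\<^sub>v ((b - A *\<^sub>v x0) - A *\<^sub>v (first_cols j V *\<^sub>v y)))
           \<le> cvec_norm (S *\<^sub>v ((b - A *\<^sub>v x0) - A *\<^sub>v (first_cols j V *\<^sub>v z)))))"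

definition sketched_fom_iterate ::
  "complex mat \<Rightarrow> complex mat \<Rightarrow> complex vec \<Rightarrow> complex vec \<Rightarrow> nat \<Rightarrow> complex vec \<Rightarrow> bool"
  where
  "sketched_fom_iterate S A b x0 m x \<longleftrightarrow>
     (\<exists>t \<in> krylov A (b - A *\<^sub>v x0) m.
        x = x0 + t \<and>
        (\<forall>w \<in> krylov A (b - A *\<^sub>v x0) m.
           (S *\<^sub>v (b - A *\<^sub>v (x0 + t))) \<bullet>c (S *\<^sub>v w) = 0))"

end

theory Submission
  imports Defs
begin

text \<open>
  In the orthonormal basis \<open>W\<close> of the sketched space every residual becomes \<open>g - Hhat y\<close> with \<open>g\<close>
  a multiple of the first unit vector, and the GMRES iterates are characterised by normal equations.
  The FOM residual is a multiple of the last unit vector.  The residual of GMRES step \<open>m - 1\<close> is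
  orthogonal to the first \<open>m - 1\<close> columns of \<open>Hhat\<close> and is therefore a multiple of the conjugate
  of row \<open>m\<close> of \<open>G\<^sub>m\<^sub>-\<^sub>1 \<cdots> G\<^sub>1\<close>.
  The rotation condition on \<open>c\<^sub>m\<close> and \<open>s\<^sub>m\<close> says exactly that \<open>c\<^sub>m\<^sup>2\<close> times the former
  plus \<open>s\<^sub>m\<^sup>2\<close> times the latter is also orthogonal to column \<open>m\<close>, so the combination solves the
  normal equations of step \<open>m\<close>, whose solution is unique.
\<close>

section \<open>Euclidean norm and best approximation\<close>

lemma cvec_norm_sq: "complex_of_real ((cvec_norm v)\<^sup>2) = (\<Sum>i<dim_vec v. v $ i * cnj (v $ i))"
  unfolding cvec_norm_def L2_set_def complex_norm_square[symmetric]
  by (simp add: sum_nonneg)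

lemma cvec_norm_eq_0:
  assumes "v \<in> carrier_vec n" "cvec_norm v = 0"
  shows "v = 0\<^sub>v n"
  using assms by (intro eq_vecI) (auto simp: cvec_norm_def L2_set_eq_0_iff)

text \<open>Otherwise subtracting \<open>t * q\<close> times \<open>a\<close> would shorten
  \<open>p\<close>: the squared norm drops by \<open>|q|^2 t (2 - t |a|^2)\<close>, which is
  positive for small \<open>t > 0\<close>.\<close>

lemma orthogonal_of_minimal_distance:
  assumes p: "p \<in> carrier_vec n" and a: "a \<in> carrier_vec n"
    and min: "\<And>\<alpha>. cvec_norm p \<le> cvec_norm (p - \<alpha> \<cdot>\<^sub>v a)"
  shows "(\<Sum>i<n. p $ i * cnj (a $ i)) = 0"
proof (rule ccontr)
  define q where "q = (\<Sum>i<n. p $ i * cnj (a $ i))"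
  \<comment> \<open>Adding 1 to the denominator gives \<open>t * |a|^2 < 1\<close> and covers
    \<open>a = 0\<close> without a case distinction.\<close>
  define t where "t = 1 / ((cvec_norm a)\<^sup>2 + 1)"
  define \<alpha> where "\<alpha> = complex_of_real t * q"
  assume "(\<Sum>i<n. p $ i * cnj (a $ i)) \<noteq> 0"
  then have q0: "cmod q \<noteq> 0" by (simp add: q_def)
  have cq: "cnj q = (\<Sum>i<n. a $ i * cnj (p $ i))"
    by (simp add: q_def mult.commute)
  have t: "t > 0" "t * (cvec_norm a)\<^sup>2 < 1"
    by (auto simp: t_def add_nonneg_pos divide_simps)
  have "complex_of_real ((cvec_norm (p - \<alpha> \<cdot>\<^sub>v a))\<^sup>2) =
      (\<Sum>i<n. p $ i * cnj (p $ i) - cnj \<alpha> * (p $ i * cnj (a $ i))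
         - \<alpha> * (a $ i * cnj (p $ i)) + \<alpha> * cnj \<alpha> * (a $ i * cnj (a $ i)))"
    unfolding cvec_norm_sq using p a by (auto simp: algebra_simps intro!: sum.cong)
  also have "\<dots> = complex_of_real ((cvec_norm p)\<^sup>2) - cnj \<alpha> * q - \<alpha> * cnj q
      + \<alpha> * cnj \<alpha> * complex_of_real ((cvec_norm a)\<^sup>2)"
    using p a unfolding cvec_norm_sq cq q_def
    by (simp add: sum.distrib sum_subtractf sum_distrib_left mult_ac)
  also have "\<dots> = complex_of_real ((cvec_norm p)\<^sup>2
      - (cmod q)\<^sup>2 * t * (2 - t * (cvec_norm a)\<^sup>2))"
  proof -
    have "complex_of_real ((cmod q)\<^sup>2) = q * cnj q" by (rule complex_norm_square)
    then show ?thesis by (simp add: \<alpha>_def algebra_simps power2_eq_square)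
  qed
  finally have eq: "(cvec_norm (p - \<alpha> \<cdot>\<^sub>v a))\<^sup>2 =
      (cvec_norm p)\<^sup>2 - (cmod q)\<^sup>2 * t * (2 - t * (cvec_norm a)\<^sup>2)"
    using of_real_eq_iff by blast
  have "0 < (cmod q)\<^sup>2 * t * (2 - t * (cvec_norm a)\<^sup>2)"
    using q0 t by (intro mult_pos_pos) auto
  moreover have "(cvec_norm p)\<^sup>2 \<le> (cvec_norm (p - \<alpha> \<cdot>\<^sub>v a))\<^sup>2"
    by (intro power_mono min) (simp add: cvec_norm_def)
  ultimately show False using eq by linarith
qed

section \<open>Rows of the progressive Givens reduction\<close>

lemma givens_reduce_dim:
  "dim_row (givens_reduce H c s \<phi> j) = dim_row H"
  "dim_col (givens_reduce H c s \<phi> j) = dim_col H"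
  by (induction j) (simp_all add: givens_rotation_def)

text \<open>Rotation \<open>Suc j\<close> mixes only the rows with index \<open>j\<close> and
  \<open>Suc j\<close>. The bound \<open>j < i\<close> leaves out the rows up to \<open>j\<close>,
  which no later rotation touches.\<close>

lemma givens_reduce_Suc_index:
  assumes j: "Suc j < dim_row H" and i: "i < dim_row H" "j < i" and k: "k < dim_col H"
  shows "givens_reduce H c s \<phi> (Suc j) $$ (i, k) =
    (if i = Suc j
     then complex_of_real (c (Suc j)) * givens_reduce H c s \<phi> j $$ (Suc j, k)
       - complex_of_real (s (Suc j)) * cis (- \<phi> (Suc j)) * givens_reduce H c s \<phi> j $$ (j, k)
     else givens_reduce H c s \<phi> j $$ (i, k))"
proof -
  let ?T = "givens_reduce H c s \<phi> j"
  let ?G = "givens_rotation (dim_row H) (Suc j) (c (Suc j)) (s (Suc j)) (\<phi> (Suc j))"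
  have "givens_reduce H c s \<phi> (Suc j) $$ (i, k) =
      (\<Sum>l<dim_row H. ?G $$ (i, l) * ?T $$ (l, k))"
    using assms by (auto simp: givens_reduce_dim scalar_prod_def atLeast0LessThan
        givens_rotation_def intro!: sum.cong)
  also have "\<dots> = (\<Sum>l<dim_row H.
      (if l = i then (if i = Suc j then complex_of_real (c (Suc j)) else 1) * ?T $$ (l, k) else 0)
      + (if l = j then (if i = Suc j
          then - (complex_of_real (s (Suc j)) * cis (- \<phi> (Suc j))) else 0) * ?T $$ (l, k) else 0))"
    using assms by (intro sum.cong) (auto simp: givens_rotation_def)
  also have "\<dots> = (if i = Suc j
     then complex_of_real (c (Suc j)) * ?T $$ (Suc j, k)
       - complex_of_real (s (Suc j)) * cis (- \<phi> (Suc j)) * ?T $$ (j, k)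
     else ?T $$ (i, k))"
    using assms by (simp add: sum.distrib)
  finally show ?thesis .
qed

lemma givens_reduce_lower_rows:
  assumes "j < i" "i < dim_row H" "k < dim_col H"
  shows "givens_reduce H c s \<phi> j $$ (i, k) = H $$ (i, k)"
  using assms
proof (induction j)
  case (Suc j)
  then show ?case by (subst givens_reduce_Suc_index) auto
qed simp

text \<open>The witness \<open>w\<close> is the row with index \<open>j\<close> of \<open>G\<^sub>j \<cdots> G\<^sub>1\<close>.\<close>

lemma givens_row_exists:
  assumes H: "H \<in> carrier_mat (Suc d) d" and hess: "upper_hessenberg H"
    and giv: "progressive_givens H c s \<phi>" and j: "j < d"
  shows "\<exists>w. (\<forall>i>j. w i = 0) \<and> (\<Sum>i\<le>j. w i * cnj (w i)) = 1 \<and>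
    (\<forall>k<d. (\<Sum>i\<le>j. w i * H $$ (i, k)) = givens_reduce H c s \<phi> j $$ (j, k)) \<and>
    (\<forall>k<j. givens_reduce H c s \<phi> j $$ (j, k) = 0)"
  using j
proof (induction j)
  case 0
  show ?case by (rule exI[of _ "\<lambda>i. if i = 0 then 1 else 0"]) auto
next
  case (Suc j)
  let ?T = "givens_reduce H c s \<phi>"
  let ?c = "complex_of_real (c (Suc j))" and ?s = "complex_of_real (s (Suc j)) * cis (- \<phi> (Suc j))"
  from Suc obtain w where w: "\<forall>i>j. w i = 0" "(\<Sum>i\<le>j. w i * cnj (w i)) = 1"
    "\<forall>k<d. (\<Sum>i\<le>j. w i * H $$ (i, k)) = ?T j $$ (j, k)" "\<forall>k<j. ?T j $$ (j, k) = 0"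
    by auto
  \<comment> \<open>The lower row of the next rotation combines the still untouched unit row
    \<open>Suc j\<close>, with factor \<open>?c\<close>, and the previous row \<open>w\<close>, with
    factor \<open>- ?s\<close>.\<close>
  define v where "v i = (if i = Suc j then ?c else - ?s * w i)" for i
  have row: "?T (Suc j) $$ (Suc j, k) = ?c * H $$ (Suc j, k) - ?s * ?T j $$ (j, k)" if "k < d" for k
    using H Suc.prems that
    by (subst givens_reduce_Suc_index) (auto simp: givens_reduce_lower_rows)
  have cs: "(c (Suc j))\<^sup>2 + (s (Suc j))\<^sup>2 = 1" "?T (Suc j) $$ (Suc j, j) = 0"
    using giv H Suc.prems unfolding progressive_givens_def by force+
  \<comment> \<open>The two parts of \<open>v\<close> have disjoint supports, so its unit length
    comes from \<open>c^2 + s^2 = 1\<close>.\<close>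
  have "(\<Sum>i\<le>j. v i * cnj (v i)) = ?s * cnj ?s * (\<Sum>i\<le>j. w i * cnj (w i))"
    unfolding sum_distrib_left by (intro sum.cong) (auto simp: v_def)
  also have "\<dots> = complex_of_real ((s (Suc j))\<^sup>2)"
    unfolding w(2) unfolding complex_norm_square[symmetric] by (simp add: norm_mult)
  finally have "(\<Sum>i\<le>Suc j. v i * cnj (v i)) = complex_of_real ((c (Suc j))\<^sup>2 + (s (Suc j))\<^sup>2)"
    by (simp add: v_def power2_eq_square)
  then have "(\<Sum>i\<le>Suc j. v i * cnj (v i)) = 1" unfolding cs by simp
  moreover have "(\<Sum>i\<le>Suc j. v i * H $$ (i, k)) = ?T (Suc j) $$ (Suc j, k)" if "k < d" for k
  proof -
    have "(\<Sum>i\<le>j. v i * H $$ (i, k)) = - ?s * (\<Sum>i\<le>j. w i * H $$ (i, k))"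
      unfolding sum_distrib_left by (intro sum.cong) (auto simp: v_def)
    then show ?thesis using that w(3) row by (simp add: v_def)
  qed
  \<comment> \<open>Column \<open>j\<close> is annihilated by the rotation condition; in earlier
    columns both terms of \<open>row\<close> vanish, by the Hessenberg form and by
    induction.\<close>
  moreover have "?T (Suc j) $$ (Suc j, k) = 0" if "k < Suc j" for k
  proof (cases "k = j")
    case False
    then have "H $$ (Suc j, k) = 0"
      using hess H Suc.prems that unfolding upper_hessenberg_def by auto
    then show ?thesis using False that row w(4) Suc.prems by auto
  qed (use cs in simp)
  moreover have "\<forall>i>Suc j. v i = 0" using w(1) by (auto simp: v_def)
  ultimately show ?case by blast
qed

section \<open>The combined residual in coordinates\<close>

text \<open>Here \<open>m = Suc n\<close>, \<open>h\<close> stands for \<open>Hhat\<close>,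
  \<open>lker\<close> is nonsingularity of its square block seen from the left, and
  \<open>yP\<close> holds the previous GMRES coordinates padded by a zero. Columns before
  \<open>n\<close> are orthogonal to both residuals. With column \<open>n\<close> the inner products
  are \<open>- yF n |h (Suc n) n|^2\<close> and \<open>yF n |\<rho>|^2\<close>, which the weights
  \<open>c^2\<close> and \<open>s^2\<close> make cancel.\<close>

lemma combined_residual_orthogonal:
  fixes h :: "nat \<Rightarrow> nat \<Rightarrow> complex" and g w yF yP :: "nat \<Rightarrow> complex" and c s :: real
  assumes hess: "\<And>k. k < n \<Longrightarrow> h (Suc n) k = 0"
    and lker: "\<And>v. (\<And>k. k \<le> n \<Longrightarrow> (\<Sum>i\<le>n. v i * h i k) = 0) \<Longrightarrow> (\<And>i. i \<le> n \<Longrightarrow> v i = 0)"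
    and g: "g (Suc n) = 0"
    and w1: "(\<Sum>i\<le>n. w i * cnj (w i)) = 1"
    and w0: "\<And>k. k < n \<Longrightarrow> (\<Sum>i\<le>n. w i * h i k) = 0"
    and rot: "complex_of_real c * h (Suc n) n
      = complex_of_real s * cis \<theta> * (\<Sum>i\<le>n. w i * h i n)"
    and cs: "c\<^sup>2 + s\<^sup>2 = 1"
    and F: "\<And>i. i \<le> n \<Longrightarrow> g i = (\<Sum>l\<le>n. h i l * yF l)"
    and P: "\<And>k. k < n \<Longrightarrow>
      (\<Sum>i\<le>Suc n. (g i - (\<Sum>l\<le>n. h i l * yP l)) * cnj (h i k)) = 0"
    and yP: "yP n = 0"
    and k: "k \<le> n"
  shows "(\<Sum>i\<le>Suc n. (g i - (\<Sum>l\<le>n. h i l * (complex_of_real (c\<^sup>2) * yF l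
      + complex_of_real (s\<^sup>2) * yP l))) * cnj (h i k)) = 0"
proof -
  define \<rho> where "\<rho> = (\<Sum>i\<le>n. w i * h i n)"
  define rF where "rF i = g i - (\<Sum>l\<le>n. h i l * yF l)" for i
  define rP where "rP i = g i - (\<Sum>l\<le>n. h i l * yP l)" for i
  have split: "g i - (\<Sum>l\<le>n. h i l * (complex_of_real (c\<^sup>2) * yF l + complex_of_real (s\<^sup>2) * yP l))
      = complex_of_real (c\<^sup>2) * rF i + complex_of_real (s\<^sup>2) * rP i" for i
  proof -
    have "g i = complex_of_real (c\<^sup>2 + s\<^sup>2) * g i" using cs by simp
    then show ?thesis
      by (simp add: rF_def rP_def sum.distrib sum_distrib_left algebra_simps)
  qed
  have rF0: "rF i = 0" if "i \<le> n" for i using F that by (simp add: rF_def)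
  have last: "(\<Sum>l\<le>n. h (Suc n) l * z l) = h (Suc n) n * z n" for z
    by (subst sum.remove[of _ n]) (auto intro!: sum.neutral simp: hess)
  have rFm: "rF (Suc n) = - h (Suc n) n * yF n" by (simp add: rF_def g last)
  have rPm: "rP (Suc n) = 0" by (simp add: rP_def g last yP)
  have P': "(\<Sum>i\<le>n. rP i * cnj (h i k)) = 0" if "k < n" for k
    using P[OF that] rPm by (simp add: rP_def)
  \<comment> \<open>If \<open>\<rho>\<close> vanished, \<open>w\<close> would be a left null vector
    of the square block, against its unit length.\<close>
  have \<rho>0: "\<rho> \<noteq> 0"
  proof
    assume \<rho>: "\<rho> = 0"
    have "w i = 0" if "i \<le> n" for i
      by (rule lker[OF _ that]) (metis w0 \<rho> \<rho>_def le_neq_implies_less)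
    then show False using w1 by simp
  qed
  \<comment> \<open>As \<open>w\<close> annihilates all columns but the last, pairing with it
    extracts the last coordinate.\<close>
  have wh: "(\<Sum>i\<le>n. w i * (\<Sum>l\<le>n. h i l * z l)) = \<rho> * z n" for z
  proof -
    have "(\<Sum>i\<le>n. w i * (\<Sum>l\<le>n. h i l * z l)) = (\<Sum>l\<le>n. (\<Sum>i\<le>n. w i * h i l) * z l)"
      unfolding sum_distrib_left sum_distrib_right by (subst sum.swap) (simp add: mult.assoc)
    also have "\<dots> = \<rho> * z n"
      unfolding \<rho>_def by (subst sum.remove[of _ n]) (auto intro!: sum.neutral simp: w0)
    finally show ?thesis .
  qed
  \<comment> \<open>The factor is chosen so that \<open>rP - \<mu> cnj w\<close> is orthogonal to
    column \<open>n\<close> as well, which makes \<open>lker\<close> applicable to its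
    conjugate.\<close>
  define \<mu> where "\<mu> = (\<Sum>i\<le>n. rP i * cnj (h i n)) / cnj \<rho>"
  \<comment> \<open>\<open>cnj w\<close> and \<open>rP\<close> are both orthogonal to the first \<open>n\<close> columns, hence parallel.\<close>
  have par: "rP i = \<mu> * cnj (w i)" if "i \<le> n" for i
  proof -
    have "cnj (rP i - \<mu> * cnj (w i)) = 0"
    proof (rule lker[OF _ that])
      fix k assume k: "k \<le> n"
      have "(\<Sum>i\<le>n. cnj (rP i - \<mu> * cnj (w i)) * h i k) =
          cnj (\<Sum>i\<le>n. rP i * cnj (h i k)) - cnj \<mu> * (\<Sum>i\<le>n. w i * h i k)"
        by (simp add: sum_distrib_left sum_subtractf algebra_simps)
      also have "\<dots> = 0"
        using k \<rho>0 by (cases "k = n") (auto simp: P' w0 \<mu>_def \<rho>_def[symmetric])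
      finally show "(\<Sum>i\<le>n. cnj (rP i - \<mu> * cnj (w i)) * h i k) = 0" .
    qed
    then show ?thesis by (simp only: complex_cnj_zero_iff) simp
  qed
  \<comment> \<open>Pairing \<open>par\<close> with the unit vector \<open>w\<close> evaluates
    \<open>\<mu>\<close>; on the rows up to \<open>n\<close>, \<open>F\<close> replaces
    \<open>g\<close> by \<open>h yF\<close>.\<close>
  have "\<mu> = \<mu> * (\<Sum>i\<le>n. w i * cnj (w i))" by (simp add: w1)
  also have "\<dots> = (\<Sum>i\<le>n. w i * rP i)"
    by (simp add: par sum_distrib_left mult.left_commute)
  also have "\<dots> = (\<Sum>i\<le>n. w i * (\<Sum>l\<le>n. h i l * yF l)) - (\<Sum>i\<le>n. w i * (\<Sum>l\<le>n. h i l * yP l))"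
    by (simp add: rP_def F right_diff_distrib sum_subtractf)
  also have "\<dots> = \<rho> * yF n" by (simp add: wh yP)
  finally have \<mu>: "\<mu> = \<rho> * yF n" .
  \<comment> \<open>Taking squared moduli in \<open>rot\<close> removes the phase.\<close>
  have norms: "complex_of_real (c\<^sup>2) * (h (Suc n) n * cnj (h (Suc n) n))
      = complex_of_real (s\<^sup>2) * (\<rho> * cnj \<rho>)"
  proof -
    have "(complex_of_real c * h (Suc n) n) * cnj (complex_of_real c * h (Suc n) n)
        = (complex_of_real s * cis \<theta> * \<rho>) * cnj (complex_of_real s * cis \<theta> * \<rho>)"
      unfolding rot \<rho>_def by simp
    then show ?thesis
      unfolding complex_norm_square[symmetric] by (simp add: norm_mult power_mult_distrib)
  qed
  have "(\<Sum>i\<le>Suc n. (complex_of_real (c\<^sup>2) * rF i + complex_of_real (s\<^sup>2) * rP i) * cnj (h i k))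
      = complex_of_real (s\<^sup>2) * (\<Sum>i\<le>n. rP i * cnj (h i k))
        - complex_of_real (c\<^sup>2) * h (Suc n) n * yF n * cnj (h (Suc n) k)"
    by (simp add: rF0 rPm rFm sum_distrib_left mult.assoc)
  also have "\<dots> = 0"
  proof (cases "k = n")
    case True
    have "(\<Sum>i\<le>n. rP i * cnj (h i n)) = \<rho> * yF n * cnj \<rho>"
      using \<mu> \<rho>0 by (simp add: \<mu>_def field_simps)
    then show ?thesis using norms True by (simp add: algebra_simps)
  next
    case False
    then show ?thesis using k by (simp add: P' hess)
  qed
  finally show ?thesis by (simp only: split)
qed

section \<open>Coordinates: zero padding, isometries and kernels\<close>

lemma mult_mat_vec_index:
  assumes "M \<in> carrier_mat nr nc" "v \<in> carrier_vec nc" "i < nr"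
  shows "(M *\<^sub>v v) $ i = (\<Sum>l<nc. M $$ (i, l) * v $ l)"
  using assms by (auto simp: scalar_prod_def atLeast0LessThan intro!: sum.cong)

text \<open>Zero padding puts the iterates of different steps into one basis, so that their
  coordinates can be combined.\<close>

lemma first_cols_mult_vec:
  assumes V: "V \<in> carrier_mat N p" and j: "j \<le> k" "k \<le> p" and y: "y \<in> carrier_vec j"
  shows "first_cols j V *\<^sub>v y = first_cols k V *\<^sub>v vec k (\<lambda>i. if i < j then y $ i else 0)"
proof (rule eq_vecI)
  fix i assume "i < dim_vec (first_cols k V *\<^sub>v vec k (\<lambda>i. if i < j then y $ i else 0))"
  then have i: "i < N" using V by (simp add: leading_block_def)
  have c: "first_cols l V \<in> carrier_mat N l" for l using V by (simp add: leading_block_def)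
  have "(\<Sum>l<j. V $$ (i, l) * y $ l) = (\<Sum>l<k. V $$ (i, l) * (if l < j then y $ l else 0))"
    using j by (intro sum.mono_neutral_cong_left) auto
  then show "(first_cols j V *\<^sub>v y) $ i =
      (first_cols k V *\<^sub>v vec k (\<lambda>i. if i < j then y $ i else 0)) $ i"
    unfolding mult_mat_vec_index[OF c y i] mult_mat_vec_index[OF c vec_carrier i]
    using i V by (simp add: leading_block_def)
qed (simp add: leading_block_def)

lemma isometry_inner:
  assumes W: "W \<in> carrier_mat k n" and iso: "mat_adjoint W * W = 1\<^sub>m n"
    and p: "p \<in> carrier_vec n" and q: "q \<in> carrier_vec n"
  shows "(\<Sum>i<k. (W *\<^sub>v p) $ i * cnj ((W *\<^sub>v q) $ i)) = (\<Sum>i<n. p $ i * cnj (q $ i))"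
proof -
  have delta: "(\<Sum>i<k. W $$ (i, a) * cnj (W $$ (i, b))) = (if a = b then 1 else 0)"
    if "a < n" "b < n" for a b
  proof -
    have "(mat_adjoint W * W) $$ (b, a) = (\<Sum>i<k. W $$ (i, a) * cnj (W $$ (i, b)))"
      using W that
      by (auto simp: mat_adjoint_def scalar_prod_def atLeast0LessThan mult.commute intro!: sum.cong)
    then show ?thesis using that unfolding iso by auto
  qed
  have "(\<Sum>i<k. (W *\<^sub>v p) $ i * cnj ((W *\<^sub>v q) $ i)) =
      (\<Sum>i<k. \<Sum>a<n. \<Sum>b<n. p $ a * cnj (q $ b) * (W $$ (i, a) * cnj (W $$ (i, b))))"
    by (intro sum.cong)
      (auto simp: mult_mat_vec_index[OF W p] mult_mat_vec_index[OF W q] sum_product mult_ac)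
  also have "\<dots> = (\<Sum>a<n. \<Sum>i<k. \<Sum>b<n. p $ a * cnj (q $ b) * (W $$ (i, a) * cnj (W $$ (i, b))))"
    by (rule sum.swap)
  also have "\<dots> = (\<Sum>a<n. \<Sum>b<n. \<Sum>i<k. p $ a * cnj (q $ b) * (W $$ (i, a) * cnj (W $$ (i, b))))"
    by (intro sum.cong refl sum.swap)
  also have "\<dots> = (\<Sum>a<n. \<Sum>b<n. if b = a then p $ a * cnj (q $ b) else 0)"
    unfolding sum_distrib_left[symmetric] by (intro sum.cong) (auto simp: delta)
  also have "\<dots> = (\<Sum>i<n. p $ i * cnj (q $ i))" by simp
  finally show ?thesis .
qed

lemma isometry_cvec_norm:
  assumes W: "W \<in> carrier_mat k n" and iso: "mat_adjoint W * W = 1\<^sub>m n"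
    and p: "p \<in> carrier_vec n"
  shows "cvec_norm (W *\<^sub>v p) = cvec_norm p"
proof -
  have "complex_of_real ((cvec_norm (W *\<^sub>v p))\<^sup>2) = complex_of_real ((cvec_norm p)\<^sup>2)"
    unfolding cvec_norm_sq using isometry_inner[OF W iso p p] W p by simp
  then have "(cvec_norm (W *\<^sub>v p))\<^sup>2 = (cvec_norm p)\<^sup>2" by (simp only: of_real_eq_iff)
  then show ?thesis by (simp add: cvec_norm_def power2_eq_iff_nonneg)
qed

text \<open>An inverse makes the determinant nonzero, and the transpose has the same determinant.
  The second claim serves as a statement about the left kernel of \<open>M\<close>.\<close>

lemma invertible_kernel:
  fixes M :: "complex mat"
  assumes M: "M \<in> carrier_mat n n" "invertible_mat M"
  shows "v \<in> carrier_vec n \<Longrightarrow> M *\<^sub>v v = 0\<^sub>v n \<Longrightarrow> v = 0\<^sub>v n"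
    and "v \<in> carrier_vec n \<Longrightarrow> transpose_mat M *\<^sub>v v = 0\<^sub>v n \<Longrightarrow> v = 0\<^sub>v n"
proof -
  obtain C where C: "M * C = 1\<^sub>m (dim_row M)" "C * M = 1\<^sub>m (dim_row C)"
    using M(2) by (auto simp: invertible_mat_def inverts_mat_def)
  \<comment> \<open>\<open>invertible_mat\<close> leaves the size of \<open>C\<close> open;
    comparing the column counts in both products fixes it.\<close>
  have "C \<in> carrier_mat n n"
    using M(1) arg_cong[OF C(1), of dim_col] arg_cong[OF C(2), of dim_col] by auto
  then have d: "det M \<noteq> 0"
    using det_mult[OF M(1), of C] M(1) C(1) by auto
  then show "v \<in> carrier_vec n \<Longrightarrow> M *\<^sub>v v = 0\<^sub>v n \<Longrightarrow> v = 0\<^sub>v n"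
    using det_0_iff_vec_prod_zero[OF M(1)] by blast
  have "det (transpose_mat M) \<noteq> 0" using d det_transpose[OF M(1)] by simp
  then show "v \<in> carrier_vec n \<Longrightarrow> transpose_mat M *\<^sub>v v = 0\<^sub>v n \<Longrightarrow> v = 0\<^sub>v n"
    using det_0_iff_vec_prod_zero[of "transpose_mat M" n] M(1) by auto
qed

section \<open>Normal equations of GMRES\<close>

text \<open>Perturbing a coordinate \<open>l < j\<close> moves the residual along column
  \<open>l\<close> of \<open>B\<close>, so minimality yields orthogonality. Coordinates have
  dimension \<open>m\<close> at every step \<open>j\<close>, with zeros from index \<open>j\<close>
  on.\<close>

lemma gmres_normal_equations:
  assumes V: "V \<in> carrier_mat N p" and B: "B \<in> carrier_mat k m" and g: "g \<in> carrier_vec k"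
    and x0: "x0 \<in> carrier_vec N" and m: "m \<le> p" and j: "j \<le> m"
    and resid: "\<And>y. y \<in> carrier_vec m \<Longrightarrow>
      cvec_norm (S *\<^sub>v ((b - A *\<^sub>v x0) - A *\<^sub>v (first_cols m V *\<^sub>v y))) = cvec_norm (g - B *\<^sub>v y)"
    and it: "sketched_gmres_iterate S A b x0 V j x"
  obtains y where "y \<in> carrier_vec m" "x = x0 + first_cols m V *\<^sub>v y"
    "\<And>i. j \<le> i \<Longrightarrow> i < m \<Longrightarrow> y $ i = 0"
    "\<And>l. l < j \<Longrightarrow> (\<Sum>i<k. (g - B *\<^sub>v y) $ i * cnj (B $$ (i, l))) = 0"
proof (cases "j = 0")
  \<comment> \<open>Step 0 returns \<open>x0\<close>, represented by zero coordinates; the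
    orthogonality conditions are vacuous.\<close>
  case True
  have c: "first_cols m V \<in> carrier_mat N m" using V by (simp add: leading_block_def)
  have "first_cols m V *\<^sub>v 0\<^sub>v m = 0\<^sub>v N"
    using c by (intro eq_vecI) auto
  then show ?thesis using that[of "0\<^sub>v m"] True it x0 by (simp add: sketched_gmres_iterate_def)
next
  case False
  define pad :: "complex vec \<Rightarrow> complex vec"
    where "pad z = vec m (\<lambda>i. if i < j then z $ i else 0)" for z
  have pad: "pad z \<in> carrier_vec m" for z by (simp add: pad_def)
  have colsj: "first_cols j V *\<^sub>v z = first_cols m V *\<^sub>v pad z" if "z \<in> carrier_vec j" for z
    unfolding pad_def using first_cols_mult_vec[OF V j m that] .
  obtain y where y: "y \<in> carrier_vec j" "x = x0 + first_cols m V *\<^sub>v pad y"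
    and min: "\<And>z. z \<in> carrier_vec j \<Longrightarrow> cvec_norm (g - B *\<^sub>v pad y) \<le> cvec_norm (g - B *\<^sub>v pad z)"
    using it False by (auto simp: sketched_gmres_iterate_def colsj resid[OF pad])
  show ?thesis
  proof (rule that[OF pad y(2)])
    fix l assume l: "l < j"
    have "(\<Sum>i<k. (g - B *\<^sub>v pad y) $ i * cnj (col B l $ i)) = 0"
    proof (rule orthogonal_of_minimal_distance)
      fix \<alpha>
      have e: "pad (y + \<alpha> \<cdot>\<^sub>v unit_vec j l) = pad y + \<alpha> \<cdot>\<^sub>v unit_vec m l"
        using y l j by (intro eq_vecI) (auto simp: pad_def)
      have "B *\<^sub>v unit_vec m l = col B l"
        using B l j by (intro eq_vecI) (auto simp: scalar_prod_right_unit)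
      then have "g - B *\<^sub>v pad (y + \<alpha> \<cdot>\<^sub>v unit_vec j l) = g - B *\<^sub>v pad y - \<alpha> \<cdot>\<^sub>v col B l"
        unfolding e using B g pad[of y] l j
        by (subst mult_add_distrib_mat_vec[OF B]) (auto simp: mult_mat_vec[OF B] intro!: eq_vecI)
      then show "cvec_norm (g - B *\<^sub>v pad y) \<le> cvec_norm (g - B *\<^sub>v pad y - \<alpha> \<cdot>\<^sub>v col B l)"
        using min[of "y + \<alpha> \<cdot>\<^sub>v unit_vec j l"] y by simp
    qed (use B g pad[of y] l j in auto)
    moreover have "col B l $ i = B $$ (i, l)" if "i < k" for i using B l j that by simp
    ultimately show "(\<Sum>i<k. (g - B *\<^sub>v pad y) $ i * cnj (B $$ (i, l))) = 0" by simp
  qed (simp add: pad_def)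
qed

text \<open>The two residuals differ by \<open>B d\<close>, which is orthogonal to all columns of
  \<open>B\<close> and hence to itself; injectivity then gives \<open>d = 0\<close>.\<close>

lemma normal_equations_unique:
  assumes B: "B \<in> carrier_mat k m" and g: "g \<in> carrier_vec k"
    and inj: "\<And>d. d \<in> carrier_vec m \<Longrightarrow> B *\<^sub>v d = 0\<^sub>v k \<Longrightarrow> d = 0\<^sub>v m"
    and y: "y \<in> carrier_vec m"
      "\<And>l. l < m \<Longrightarrow> (\<Sum>i<k. (g - B *\<^sub>v y) $ i * cnj (B $$ (i, l))) = 0"
    and z: "z \<in> carrier_vec m"
      "\<And>l. l < m \<Longrightarrow> (\<Sum>i<k. (g - B *\<^sub>v z) $ i * cnj (B $$ (i, l))) = 0"
  shows "y = z"
proof -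
  define d where "d = z - y"
  have d: "d \<in> carrier_vec m" using y z by (simp add: d_def)
  have Bd: "(B *\<^sub>v d) $ i = (g - B *\<^sub>v y) $ i - (g - B *\<^sub>v z) $ i" if "i < k" for i
    unfolding d_def mult_minus_distrib_mat_vec[OF B z(1) y(1)] using that B g by simp
  have orth: "(\<Sum>i<k. (B *\<^sub>v d) $ i * cnj (B $$ (i, l))) = 0" if "l < m" for l
    using y(2)[OF that] z(2)[OF that] by (simp add: Bd left_diff_distrib sum_subtractf)
  have "complex_of_real ((cvec_norm (B *\<^sub>v d))\<^sup>2) =
      (\<Sum>i<k. \<Sum>l<m. (B *\<^sub>v d) $ i * cnj (B $$ (i, l)) * cnj (d $ l))"
    unfolding cvec_norm_sq using B d
    by (intro sum.cong) (auto simp: mult_mat_vec_index[OF B d] sum_distrib_left mult_ac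
        simp del: index_mult_mat_vec)
  also have "\<dots> = (\<Sum>l<m. (\<Sum>i<k. (B *\<^sub>v d) $ i * cnj (B $$ (i, l))) * cnj (d $ l))"
    unfolding sum_distrib_right by (rule sum.swap)
  also have "\<dots> = 0" by (intro sum.neutral ballI) (simp only: orth lessThan_iff mult_zero_left)
  finally have "cvec_norm (B *\<^sub>v d) = 0" by simp
  then have "B *\<^sub>v d = 0\<^sub>v k" using B d by (intro cvec_norm_eq_0) auto
  then have d0: "d = 0\<^sub>v m" using d inj by blast
  show ?thesis
  proof (rule eq_vecI)
    fix i assume "i < dim_vec z"
    then show "y $ i = z $ i" using y(1) z(1) arg_cong[OF d0, of "\<lambda>v. v $ i"] by (simp add: d_def)
  qed (use y z in auto)
qed

theorem theorem4p8:
  fixes N sd m :: nat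
    and A S V H W R Hhat :: "complex mat"
    and b x0 r0 xG xG' xF :: "complex vec"
    and c s \<phi> :: "nat \<Rightarrow> real"
  assumes A: "A \<in> carrier_mat N N"
    and b: "b \<in> carrier_vec N"
    and x0: "x0 \<in> carrier_vec N"
    and r0: "r0 = b - A *\<^sub>v x0"
    and r0_nonzero: "r0 \<noteq> 0\<^sub>v N"
    and m: "m \<ge> 1"
    and V: "V \<in> carrier_mat N (m + 1)"
    and V_indpt: "lin_indpt_cols V"
    and V_first: "col V 0 = complex_of_real (1 / cvec_norm r0) \<cdot>\<^sub>v r0"
    and V_krylov: "\<And>j. 1 \<le> j \<Longrightarrow> j \<le> m + 1 \<Longrightarrow> cols_basis_of (first_cols j V) (krylov A r0 j)"
    and H: "H \<in> carrier_mat (m + 1) m"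
    and H_hess: "upper_hessenberg H"
    and arnoldi: "A * first_cols m V = V * H"
    and S: "S \<in> carrier_mat sd N"
    and SV_rank: "vec_space.rank sd (S * V) = m + 1"
    and SV_qr: "economy_qr (S * V) W R"
    and Hhat: "Hhat = R * H"
    and Hhat_nonsing: "invertible_mat (leading_block m m Hhat)"
    and givens: "progressive_givens Hhat c s \<phi>"
    and gmres_prev: "sketched_gmres_iterate S A b x0 V (m - 1) xG'"
    and gmres: "sketched_gmres_iterate S A b x0 V m xG"
    and fom: "sketched_fom_iterate S A b x0 m xF"
  shows "xG = complex_of_real ((c m)\<^sup>2) \<cdot>\<^sub>v xF + complex_of_real ((s m)\<^sup>2) \<cdot>\<^sub>v xG'"
proof -

  \<comment> \<open>The Hessenberg matrix \<open>Hhat\<close>\<close>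
  \<comment> \<open>\<open>n = m - 1\<close> is both the last column index of \<open>Hhat\<close>
    and the number of the previous GMRES step.\<close>
  obtain n where n: "m = Suc n" using m by (cases m) auto
  have W: "W \<in> carrier_mat sd (m + 1)" and R: "R \<in> carrier_mat (m + 1) (m + 1)"
    and SVWR: "S * V = W * R" and iso: "mat_adjoint W * W = 1\<^sub>m (m + 1)"
    and Rtri: "upper_triangular R" and Rdiag: "\<And>i. i < m + 1 \<Longrightarrow> R $$ (i, i) \<noteq> 0"
    using SV_qr S V by (auto simp: economy_qr_def)
  have Rlow: "R $$ (i, k) = 0" if "k < i" "i < m + 1" for i k
    using Rtri R that by auto
  have Hh: "Hhat \<in> carrier_mat (m + 1) m" using R H by (simp add: Hhat)
  \<comment> \<open>In the product \<open>R * H\<close> the factor from \<open>R\<close> vanishes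
    for \<open>l < i\<close> and the factor from \<open>H\<close> for
    \<open>i \<le> l\<close>.\<close>
  have hess: "Hhat $$ (i, k) = 0" if "k + 1 < i" "i < m + 1" "k < m" for i k
  proof -
    have "Hhat $$ (i, k) = (\<Sum>l<m + 1. R $$ (i, l) * H $$ (l, k))"
      using R H that by (auto simp: Hhat scalar_prod_def atLeast0LessThan)
    also have "\<dots> = 0"
    proof (intro sum.neutral ballI)
      fix l assume "l \<in> {..<m + 1}"
      then show "R $$ (i, l) * H $$ (l, k) = 0"
        using Rlow[of l i] H_hess H that by (cases "l < i") (auto simp: upper_hessenberg_def)
    qed
    finally show ?thesis .
  qed

  \<comment> \<open>Residuals in the basis \<open>W\<close>\<close>
  define Vm where "Vm = first_cols m V"
  have Vm: "Vm \<in> carrier_mat N m" using V by (simp add: Vm_def leading_block_def)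
  have r0c: "r0 \<in> carrier_vec N" using r0 A b x0 by simp
  \<comment> \<open>The first column of \<open>V\<close> is the normalised \<open>r0\<close>, so
    \<open>S r0\<close> is \<open>|r0|\<close> times the first column of \<open>W * R\<close>, and
    that column of \<open>R\<close> has only its diagonal entry.\<close>
  define g where "g = vec (m + 1) (\<lambda>i. if i = 0 then complex_of_real (cvec_norm r0) * R $$ (0, 0) else 0)"
  have g: "g \<in> carrier_vec (m + 1)" by (simp add: g_def)
  have Sr0: "S *\<^sub>v r0 = W *\<^sub>v g"
  proof -
    define e where "e = complex_of_real (cvec_norm r0) \<cdot>\<^sub>v unit_vec (m + 1) 0"
    have e: "e \<in> carrier_vec (m + 1)" by (simp add: e_def)
    have nz: "cvec_norm r0 \<noteq> 0" using cvec_norm_eq_0[OF r0c] r0_nonzero by blast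
    have "r0 = complex_of_real (cvec_norm r0) \<cdot>\<^sub>v col V 0"
      unfolding V_first using nz by (simp add: smult_smult_assoc)
    also have "\<dots> = V *\<^sub>v e"
      unfolding e_def using V by (intro eq_vecI) (auto simp: scalar_prod_right_unit)
    finally have "S *\<^sub>v r0 = (S * V) *\<^sub>v e" using S V e by simp
    also have "\<dots> = W *\<^sub>v (R *\<^sub>v e)" unfolding SVWR using W R e by simp
    also have "R *\<^sub>v e = g"
      unfolding e_def g_def using R Rlow by (intro eq_vecI) (auto simp: scalar_prod_right_unit)
    finally show ?thesis .
  qed
  have resid: "S *\<^sub>v (r0 - A *\<^sub>v (Vm *\<^sub>v y)) = W *\<^sub>v (g - Hhat *\<^sub>v y)" if y: "y \<in> carrier_vec m" for y
  proof -
    have "A *\<^sub>v (Vm *\<^sub>v y) = V *\<^sub>v (H *\<^sub>v y)"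
      using arnoldi A Vm V H y unfolding Vm_def[symmetric] by (metis assoc_mult_mat_vec)
    then have "S *\<^sub>v (A *\<^sub>v (Vm *\<^sub>v y)) = (S * V) *\<^sub>v (H *\<^sub>v y)"
      using S V H y by simp
    also have "\<dots> = W *\<^sub>v (Hhat *\<^sub>v y)"
      unfolding SVWR Hhat using W R H y by simp
    finally show ?thesis
      using S A Vm y r0c W g Hh Sr0
      by (simp add: mult_minus_distrib_mat_vec[of _ sd N] mult_minus_distrib_mat_vec[of _ sd "m + 1"])
  qed
  have resid_norm: "cvec_norm (S *\<^sub>v ((b - A *\<^sub>v x0) - A *\<^sub>v (first_cols m V *\<^sub>v y)))
      = cvec_norm (g - Hhat *\<^sub>v y)" if y: "y \<in> carrier_vec m" for y
    using resid[OF y] isometry_cvec_norm[OF W iso, of "g - Hhat *\<^sub>v y"] g Hh y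
    by (simp add: r0[symmetric] Vm_def)

  \<comment> \<open>The two GMRES iterates\<close>
  obtain yG where yG: "yG \<in> carrier_vec m" "xG = x0 + Vm *\<^sub>v yG"
    "\<And>l. l < m \<Longrightarrow> (\<Sum>i<m + 1. (g - Hhat *\<^sub>v yG) $ i * cnj (Hhat $$ (i, l))) = 0"
    using gmres_normal_equations[OF V Hh g x0 _ _ resid_norm gmres] unfolding Vm_def by auto
  \<comment> \<open>Step \<open>n\<close> uses the first \<open>n\<close> columns only, so its
    padded coordinates vanish at index \<open>n\<close>.\<close>
  obtain yP where yP: "yP \<in> carrier_vec m" "xG' = x0 + Vm *\<^sub>v yP" "yP $ n = 0"
    "\<And>l. l < n \<Longrightarrow> (\<Sum>i<m + 1. (g - Hhat *\<^sub>v yP) $ i * cnj (Hhat $$ (i, l))) = 0"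
    by (rule gmres_normal_equations[OF V Hh g x0 _ _ resid_norm gmres_prev, folded Vm_def])
      (use n in auto)

  \<comment> \<open>The FOM residual\<close>
  \<comment> \<open>The Krylov space is the range of \<open>Vm\<close>, so trial and test vectors of
    FOM both take the form \<open>Vm z\<close>.\<close>
  have kry: "krylov A r0 m = (*\<^sub>v) Vm ` carrier_vec m"
  proof -
    have "krylov A r0 m = vec_space.col_space N Vm"
      using V_krylov[of m] m Vm
      by (simp add: cols_basis_of_def Vm_def[symmetric] vec_space.col_space_def)
    then show ?thesis using vec_space.col_space_eq[OF Vm] Vm by auto
  qed
  obtain yF where yF: "yF \<in> carrier_vec m" "xF = x0 + Vm *\<^sub>v yF"
    and orthF: "\<And>z. z \<in> carrier_vec m \<Longrightarrow>
      (S *\<^sub>v (b - A *\<^sub>v (x0 + Vm *\<^sub>v yF))) \<bullet>c (S *\<^sub>v (Vm *\<^sub>v z)) = 0"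
    using fom unfolding sketched_fom_iterate_def r0[symmetric] kry by blast
  define rF where "rF = g - Hhat *\<^sub>v yF"
  have rF: "rF \<in> carrier_vec (m + 1)" using g Hh yF by (simp add: rF_def)
  \<comment> \<open>Test with column \<open>k\<close> of \<open>Vm\<close>: its sketch is
    \<open>W\<close> times column \<open>k\<close> of \<open>R\<close>, and the isometry removes
    \<open>W\<close>.\<close>
  have rFR: "(\<Sum>i<m + 1. rF $ i * cnj (R $$ (i, k))) = 0" if k: "k < m" for k
  proof -
    have "b - A *\<^sub>v (x0 + Vm *\<^sub>v yF) = r0 - A *\<^sub>v (Vm *\<^sub>v yF)"
      unfolding r0 using A b x0 Vm yF(1)
      by (subst mult_add_distrib_mat_vec[OF A]) (auto intro!: eq_vecI)
    then have 1: "S *\<^sub>v (b - A *\<^sub>v (x0 + Vm *\<^sub>v yF)) = W *\<^sub>v rF"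
      using resid[OF yF(1)] by (simp add: rF_def)
    have "Vm *\<^sub>v unit_vec m k = V *\<^sub>v unit_vec (m + 1) k"
      using Vm V k
      by (intro eq_vecI) (auto simp: scalar_prod_right_unit Vm_def leading_block_def)
    then have "S *\<^sub>v (Vm *\<^sub>v unit_vec m k) = (S * V) *\<^sub>v unit_vec (m + 1) k"
      using S V by simp
    also have "\<dots> = W *\<^sub>v col R k"
      unfolding SVWR using W R k
      by (subst assoc_mult_mat_vec[OF W R])
        (auto intro!: arg_cong[of _ _ "(*\<^sub>v) W"] eq_vecI simp: scalar_prod_right_unit)
    finally have "(W *\<^sub>v rF) \<bullet>c (W *\<^sub>v col R k) = 0"
      using orthF[of "unit_vec m k"] 1 by simp
    then have "(\<Sum>i<sd. (W *\<^sub>v rF) $ i * cnj ((W *\<^sub>v col R k) $ i)) = 0"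
      using W by (simp add: scalar_prod_def atLeast0LessThan)
    then show ?thesis
      using isometry_inner[OF W iso rF col_carrier_vec[OF _ R]] R k by simp
  qed
  \<comment> \<open>Forward substitution in \<open>rFR\<close>: column \<open>k\<close> of
    \<open>R\<close> is zero below its nonzero diagonal entry, and the entries of \<open>rF\<close>
    before \<open>k\<close> vanish by induction. Only the entry with index \<open>m\<close> can
    survive.\<close>
  have rF0: "rF $ k = 0" if "k < m" for k
    using that
  proof (induction k rule: less_induct)
    case (less k)
    have "(\<Sum>i<m + 1. rF $ i * cnj (R $$ (i, k))) = rF $ k * cnj (R $$ (k, k))"
    proof (subst sum.remove[of _ k])
      have "rF $ i * cnj (R $$ (i, k)) = 0" if "i < m + 1" "i \<noteq> k" for i
        using less that Rlow[of k i] by (cases "i < k") auto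
      then have "(\<Sum>i\<in>{..<m + 1} - {k}. rF $ i * cnj (R $$ (i, k))) = 0"
        by (intro sum.neutral) blast
      then show "rF $ k * cnj (R $$ (k, k)) + (\<Sum>i\<in>{..<m + 1} - {k}. rF $ i * cnj (R $$ (i, k)))
          = rF $ k * cnj (R $$ (k, k))"
        by simp
    qed (use less in auto)
    then show ?case using rFR[OF less.prems] Rdiag[of k] less.prems by simp
  qed

  \<comment> \<open>The last rotation and nonsingularity of the square block\<close>
  obtain w where w: "(\<Sum>i\<le>n. w i * cnj (w i)) = 1"
    "\<And>k. k < m \<Longrightarrow> (\<Sum>i\<le>n. w i * Hhat $$ (i, k)) = givens_reduce Hhat c s \<phi> n $$ (n, k)"
    "\<And>k. k < n \<Longrightarrow> givens_reduce Hhat c s \<phi> n $$ (n, k) = 0"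
    using givens_row_exists[of Hhat m c s \<phi> n] Hh hess givens n
    by (auto simp: upper_hessenberg_def)
  have cs: "(c m)\<^sup>2 + (s m)\<^sup>2 = 1" "givens_reduce Hhat c s \<phi> (Suc n) $$ (Suc n, n) = 0"
    using givens Hh n unfolding progressive_givens_def by force+
  \<comment> \<open>This is the entry annihilated by rotation \<open>m\<close>, expanded; row
    \<open>Suc n\<close> of \<open>Hhat\<close> is untouched before that rotation.\<close>
  have rot: "complex_of_real (c m) * Hhat $$ (Suc n, n)
      = complex_of_real (s m) * cis (- \<phi> m) * (\<Sum>i\<le>n. w i * Hhat $$ (i, n))"
    using cs(2) Hh n w(2)[of n]
    by (simp add: givens_reduce_Suc_index givens_reduce_lower_rows del: givens_reduce.simps)
  define B where "B = leading_block m m Hhat"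
  have B: "B \<in> carrier_mat m m" by (simp add: B_def leading_block_def)
  note ker = invertible_kernel[OF B Hhat_nonsing[folded B_def]]
  have lker: "v i = 0"
    if z: "\<And>k. k \<le> n \<Longrightarrow> (\<Sum>i\<le>n. v i * Hhat $$ (i, k)) = 0" and i: "i \<le> n" for v i
  proof -
    have "transpose_mat B *\<^sub>v vec m v = 0\<^sub>v m"
    proof (rule eq_vecI)
      fix k assume "k < dim_vec (0\<^sub>v m :: complex vec)"
      then have k: "k < m" by simp
      have "(transpose_mat B *\<^sub>v vec m v) $ k = (\<Sum>i<m. B $$ (i, k) * v i)"
        using B k by (subst mult_mat_vec_index[of _ m m]) auto
      also have "\<dots> = (\<Sum>i\<le>n. v i * Hhat $$ (i, k))"
        using k unfolding n lessThan_Suc_atMost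
        by (intro sum.cong) (auto simp: B_def leading_block_def n)
      finally show "(transpose_mat B *\<^sub>v vec m v) $ k = 0\<^sub>v m $ k" using z k n by simp
    qed (use B in simp)
    then have "vec m v = 0\<^sub>v m" using ker(2) by simp
    then show ?thesis using i n by (metis index_vec index_zero_vec(1) le_imp_less_Suc)
  qed
  have inj: "d = 0\<^sub>v m" if d: "d \<in> carrier_vec m" and z: "Hhat *\<^sub>v d = 0\<^sub>v (m + 1)" for d
  proof (rule ker(1)[OF d])
    have "(B *\<^sub>v d) $ i = (Hhat *\<^sub>v d) $ i" if "i < m" for i
      using that unfolding mult_mat_vec_index[OF B d that]
      by (subst mult_mat_vec_index[OF Hh d]) (auto simp: B_def leading_block_def)
    then show "B *\<^sub>v d = 0\<^sub>v m" unfolding z using B by (intro eq_vecI) auto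
  qed

  \<comment> \<open>The combination solves the normal equations of step \<open>m\<close>\<close>
  define y where "y = complex_of_real ((c m)\<^sup>2) \<cdot>\<^sub>v yF + complex_of_real ((s m)\<^sup>2) \<cdot>\<^sub>v yP"
  have y: "y \<in> carrier_vec m" using yF yP by (simp add: y_def)
  have idx: "(g - Hhat *\<^sub>v z) $ i = g $ i - (\<Sum>l\<le>n. Hhat $$ (i, l) * z $ l)"
    if "z \<in> carrier_vec m" "i < m + 1" for z i
    using that g Hh mult_mat_vec_index[OF Hh that]
    by (simp add: n lessThan_Suc_atMost del: index_mult_mat_vec)
  have norm_eq: "(\<Sum>i<m + 1. (g - Hhat *\<^sub>v z) $ i * cnj (Hhat $$ (i, k))) =
      (\<Sum>i\<le>Suc n. (g $ i - (\<Sum>l\<le>n. Hhat $$ (i, l) * z $ l)) * cnj (Hhat $$ (i, k)))"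
    if "z \<in> carrier_vec m" for z k
    using idx[OF that] by (intro sum.cong) (auto simp: n)
  have "(\<Sum>i<m + 1. (g - Hhat *\<^sub>v y) $ i * cnj (Hhat $$ (i, k))) = 0" if k: "k < m" for k
  proof -
    have "(\<Sum>i\<le>Suc n. (g $ i - (\<Sum>l\<le>n. Hhat $$ (i, l) * (complex_of_real ((c m)\<^sup>2) * yF $ l
        + complex_of_real ((s m)\<^sup>2) * yP $ l))) * cnj (Hhat $$ (i, k))) = 0"
    proof (rule combined_residual_orthogonal[where h = "\<lambda>i k. Hhat $$ (i, k)" and g = "($) g" and w = w,
          OF _ _ _ w(1) _ rot cs(1)])
      fix v i assume "\<And>k. k \<le> n \<Longrightarrow> (\<Sum>i\<le>n. v i * Hhat $$ (i, k)) = 0" "i \<le> n"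
      then show "v i = 0" by (rule lker)
    next
      fix i assume "i \<le> n"
      then show "g $ i = (\<Sum>l\<le>n. Hhat $$ (i, l) * yF $ l)"
        using rF0[of i] idx[OF yF(1), of i] n by (simp add: rF_def)
    next
      fix k assume "k < n"
      then show "(\<Sum>i\<le>Suc n. (g $ i - (\<Sum>l\<le>n. Hhat $$ (i, l) * yP $ l)) * cnj (Hhat $$ (i, k))) = 0"
        using yP(4) norm_eq[OF yP(1)] by metis
    qed (use n k hess w yP(3) in \<open>auto simp: g_def\<close>)
    moreover have "y $ l = complex_of_real ((c m)\<^sup>2) * yF $ l + complex_of_real ((s m)\<^sup>2) * yP $ l"
      if "l \<le> n" for l using that yF yP n by (simp add: y_def)
    ultimately show ?thesis unfolding norm_eq[OF y] by simp
  qed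
  then have "yG = y" using normal_equations_unique[OF Hh g inj yG(1,3) y] by blast
  then have "xG = x0 + (complex_of_real ((c m)\<^sup>2) \<cdot>\<^sub>v (Vm *\<^sub>v yF) + complex_of_real ((s m)\<^sup>2) \<cdot>\<^sub>v (Vm *\<^sub>v yP))"
    unfolding yG(2) y_def using Vm yF(1) yP(1)
    by (simp add: mult_add_distrib_mat_vec[OF Vm] mult_mat_vec[OF Vm])
  also have "\<dots> = complex_of_real ((c m)\<^sup>2) \<cdot>\<^sub>v xF + complex_of_real ((s m)\<^sup>2) \<cdot>\<^sub>v xG'"
  proof (rule eq_vecI)
    fix i assume "i < dim_vec (complex_of_real ((c m)\<^sup>2) \<cdot>\<^sub>v xF + complex_of_real ((s m)\<^sup>2) \<cdot>\<^sub>v xG')"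
    then have i: "i < N" using yP(2) x0 Vm by simp
    \<comment> \<open>The weights sum to 1, so \<open>x0\<close> can be split between the two
      iterates.\<close>
    have "x0 $ i = complex_of_real ((c m)\<^sup>2 + (s m)\<^sup>2) * x0 $ i" using cs by simp
    then show "(x0 + (complex_of_real ((c m)\<^sup>2) \<cdot>\<^sub>v (Vm *\<^sub>v yF) + complex_of_real ((s m)\<^sup>2) \<cdot>\<^sub>v (Vm *\<^sub>v yP))) $ i =
        (complex_of_real ((c m)\<^sup>2) \<cdot>\<^sub>v xF + complex_of_real ((s m)\<^sup>2) \<cdot>\<^sub>v xG') $ i"
      unfolding yF(2) yP(2) using i x0 Vm by (simp add: algebra_simps del: index_mult_mat_vec)
  qed (use yF yP x0 Vm in simp)
  finally show ?thesis .
qed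

end
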